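(* Let $\mathcal I=(t,m,n,\mathcal X,\mathcal X^{(S)},R)$ be an instance of the ICCSI problem over $\mathbb F_q$, let $N$ be a positive integer and let $L\in\mathbb F_q^{N\times d_S}$. Then $L$ represents an $\mathbb F_q$-linear $\mathcal I$-IC of length $N$ if and only if for each $i\in[m]$ we have $R_i\in\mathcal L+\mathcal X^{(i)}$, where $\mathcal L=\langle LV^{(S)}\rangle$.
   Context: Notation: $q$ is a prime power, $\mathbb F_q$ the field with $q$ elements, $[m]=\{1,\dots,m\}$. For a matrix $A$, $A_i$ is its $i$-th row and $\langle A\rangle$ its row space. Instance: an instance $\mathcal I=(t,m,n,\mathcal X,\mathcal X^{(S)},R)$ of the Index Coding with Coded Side Information (ICCSI) problem consists of positive integers $t,m,n$; subspaces $\mathcal X^{(S)}$ and $\mathcal X^{(i)}$ ($i\in[m]$) of $\mathbb F_q^n$ of dimensions $d_S$ and $d_i$; $\mathcal X=\{A\in\mathbb F_q^{m\times n}:A_i\in\mathcal X^{(i)},\ i\in[m]\}$; and a matrix $R\in\mathbb F_q^{m\times n}$ with rows $R_i\in\mathcal X^{(S)}\setminus\mathcal X^{(i)}$. Fix matrices $V^{(S)}\in\mathbb F_q^{d_S\times n}$ and $V^{(i)}\in\mathbb F_q^{d_i\times n}$ with $\langle V^{(S)}\rangle=\mathcal X^{(S)}$, $\langle V^{(i)}\rangle=\mathcal X^{(i)}$. The data matrix is $X\in\mathbb F_q^{n\times t}$; user $i$ holds $V^{(i)}$ and $V^{(i)}X$ and requests $R_iX$; the sender holds $V^{(S)}X$.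 Index codes: a map $E:\mathbb F_q^{n\times t}\to\mathbb F_q^{N\times t}$ is an $\mathcal I$-IC of length $N$ if for each $i\in[m]$ there is a decoding map $D_i:\mathbb F_q^{N\times t}\times\mathbb F_q^{d_i\times t}\to\mathbb F_q^t$ with $D_i(E(X),V^{(i)}X)=R_iX$ for all $X\in\mathbb F_q^{n\times t}$. It is $\mathbb F_q$-linear if $E(X)=LV^{(S)}X$ for some $L\in\mathbb F_q^{N\times d_S}$; then $L$ is said to represent (realize) $E$. *)

theory Defs
  imports "Jordan_Normal_Form.DL_Rank"
begin

text \<open>
  The finite field is a type of sort \<open>{field, finite}\<close>. User (row) indices run over \<open>0, \<dots>, m - 1\<close>,
  following the row indexing of \<^typ>\<open>'a mat\<close>. Elements of the row space \<open>F^n\<close> are represented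
  by \<^typ>\<open>'a vec\<close>, which does not distinguish row vectors from column vectors.
\<close>

abbreviation is_subspace :: "nat \<Rightarrow> 'a::field vec set \<Rightarrow> bool" where
  "is_subspace n W \<equiv> VectorSpace.subspace class_ring W (module_vec TYPE('a) n)"

abbreviation subspace_dim :: "nat \<Rightarrow> 'a::field vec set \<Rightarrow> nat" where
  "subspace_dim n W \<equiv> vectorspace.dim class_ring ((module_vec TYPE('a) n)\<lparr>carrier := W\<rparr>)"

abbreviation subspace_plus :: "nat \<Rightarrow> 'a::field vec set \<Rightarrow> 'a vec set \<Rightarrow> 'a vec set" where
  "subspace_plus n W1 W2 \<equiv> LinearCombinations.module.submodule_sum (module_vec TYPE('a) n) W1 W2"

abbreviation row_span :: "nat \<Rightarrow> 'a::field mat \<Rightarrow> 'a vec set" where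
  "row_span n A \<equiv> vec_space.row_space n A"

record 'a iccsi =
  data_width :: nat                     \<comment> \<open>\<open>t\<close>\<close>
  num_users :: nat                      \<comment> \<open>\<open>m\<close>\<close>
  num_blocks :: nat                     \<comment> \<open>\<open>n\<close>\<close>
  user_space :: "nat \<Rightarrow> 'a vec set"     \<comment> \<open>\<open>i \<mapsto> X\<^bsup>(i)\<^esup>\<close>; only the values at \<open>i < m\<close> matter\<close>
  sender_space :: "'a vec set"          \<comment> \<open>\<open>X\<^bsup>(S)\<^esup>\<close>\<close>
  request :: "'a mat"                   \<comment> \<open>\<open>R\<close>\<close>

text \<open>The component \<open>X\<close> of an instance; it is determined by the family of user spaces.\<close>

definition side_info :: "'a iccsi \<Rightarrow> 'a mat set" where
  "side_info I = {A \<in> carrier_mat (num_users I) (num_blocks I).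
     \<forall>i < num_users I. row A i \<in> user_space I i}"

definition iccsi_instance :: "'a::field iccsi \<Rightarrow> bool" where
  "iccsi_instance I \<longleftrightarrow>
     0 < data_width I \<and> 0 < num_users I \<and> 0 < num_blocks I \<and>
     is_subspace (num_blocks I) (sender_space I) \<and>
     (\<forall>i < num_users I. is_subspace (num_blocks I) (user_space I i)) \<and>
     request I \<in> carrier_mat (num_users I) (num_blocks I) \<and>
     (\<forall>i < num_users I. row (request I) i \<in> sender_space I - user_space I i)"

definition sender_dim :: "'a::field iccsi \<Rightarrow> nat" where
  "sender_dim I = subspace_dim (num_blocks I) (sender_space I)"

definition user_dim :: "'a::field iccsi \<Rightarrow> nat \<Rightarrow> nat" where
  "user_dim I i = subspace_dim (num_blocks I) (user_space I i)"

text \<open>\<open>VS\<close> and \<open>V i\<close> are the fixed matrices whose rows generate the sender and user spaces.\<close>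

definition generator_matrices :: "'a::field iccsi \<Rightarrow> 'a mat \<Rightarrow> (nat \<Rightarrow> 'a mat) \<Rightarrow> bool" where
  "generator_matrices I VS V \<longleftrightarrow>
     VS \<in> carrier_mat (sender_dim I) (num_blocks I) \<and>
     row_span (num_blocks I) VS = sender_space I \<and>
     (\<forall>i < num_users I. V i \<in> carrier_mat (user_dim I i) (num_blocks I) \<and>
        row_span (num_blocks I) (V i) = user_space I i)"

text \<open>The requested row vector \<open>R\<^sub>i X\<close> is written as the product of the transpose of \<open>X\<close>
  with the vector \<open>R\<^sub>i\<close>.\<close>

definition index_code :: "'a::field iccsi \<Rightarrow> (nat \<Rightarrow> 'a mat) \<Rightarrow> nat \<Rightarrow> ('a mat \<Rightarrow> 'a mat) \<Rightarrow> bool" where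
  "index_code I V N E \<longleftrightarrow>
     E \<in> carrier_mat (num_blocks I) (data_width I) \<rightarrow> carrier_mat N (data_width I) \<and>
     (\<forall>i < num_users I.
        \<exists>D \<in> carrier_mat N (data_width I) \<times> carrier_mat (user_dim I i) (data_width I)
              \<rightarrow> carrier_vec (data_width I).
          \<forall>X \<in> carrier_mat (num_blocks I) (data_width I).
            D (E X, V i * X) = transpose_mat X *\<^sub>v row (request I) i)"

definition represents :: "'a::field iccsi \<Rightarrow> 'a mat \<Rightarrow> nat \<Rightarrow> 'a mat \<Rightarrow> ('a mat \<Rightarrow> 'a mat) \<Rightarrow> bool" where
  "represents I VS N L E \<longleftrightarrow>
     L \<in> carrier_mat N (sender_dim I) \<and>
     (\<forall>X \<in> carrier_mat (num_blocks I) (data_width I). E X = L * VS * X)"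

definition linear_index_code ::
    "'a::field iccsi \<Rightarrow> 'a mat \<Rightarrow> (nat \<Rightarrow> 'a mat) \<Rightarrow> nat \<Rightarrow> ('a mat \<Rightarrow> 'a mat) \<Rightarrow> bool" where
  "linear_index_code I VS V N E \<longleftrightarrow> index_code I V N E \<and> (\<exists>L. represents I VS N L E)"

end

theory Submission
  imports Defs
begin

text \<open>
  If \<open>R\<^sub>i = A\<^sup>T u + B\<^sup>T v\<close> with \<open>A = L V\<^bsup>(S)\<^esup>\<close> and \<open>B = V\<^bsup>(i)\<^esup>\<close>, then user \<open>i\<close> decodes linearly from
  \<open>R\<^sub>i X = u\<^sup>T (A X) + v\<^sup>T (B X)\<close>. Conversely, a decoder cannot tell the zero data matrix from one
  whose first column lies in the common kernel of \<open>A\<close> and \<open>B\<close> and whose other columns vanish, so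
  \<open>R\<^sub>i\<close> vanishes on that kernel; by duality it lies in the sum of the row spaces.
\<close>

context vec_space begin
text \<open>Induction on \<open>ws\<close>, removing one constraint at a time. If \<open>r\<close>
  already vanishes on the common kernel of the tail, the induction hypothesis applies to
  \<open>r\<close> itself; otherwise it applies to \<open>r\<close> corrected by a suitable multiple
  of \<open>w\<close>.\<close>

lemma vanishing_on_common_kernel_in_span:
  assumes "set ws \<subseteq> carrier_vec n" and "r \<in> carrier_vec n"
    and "\<And>x. x \<in> carrier_vec n \<Longrightarrow> \<forall>w \<in> set ws. w \<bullet> x = 0 \<Longrightarrow> r \<bullet> x = 0"
  shows "r \<in> span (set ws)"
  using assms
proof (induction ws arbitrary: r)
  case Nil
  \<comment> \<open>With no constraints every vector is in the kernel, so \<open>r\<close> can be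
    tested on the unit vectors.\<close>
  have "r $ i = 0" if "i < n" for i
    using Nil.prems(2) Nil.prems(3)[of "unit_vec n i"] that by simp
  then have "r = 0\<^sub>v n"
    using Nil.prems(2) by (intro eq_vecI) auto
  then show ?case by (simp add: span_empty)
next
  case (Cons w ws)
  from Cons.prems have w: "w \<in> carrier_vec n" and ws: "set ws \<subseteq> carrier_vec n" by auto
  have mono: "span (set ws) \<subseteq> span (set (w # ws))"
    by (rule span_is_monotone) auto
  show ?case
  proof (cases "\<forall>x \<in> carrier_vec n. (\<forall>u \<in> set ws. u \<bullet> x = 0) \<longrightarrow> r \<bullet> x = 0")
    case True
    then show ?thesis using Cons.IH[OF ws Cons.prems(2)] mono by blast
  next
    case False
    then obtain x0 where x0: "x0 \<in> carrier_vec n" "\<forall>u \<in> set ws. u \<bullet> x0 = 0" and rx0: "r \<bullet> x0 \<noteq> 0"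
      by blast
    have wx0: "w \<bullet> x0 \<noteq> 0" using Cons.prems(3)[OF x0(1)] x0(2) rx0 by auto
    \<comment> \<open>This is the scalar for which \<open>r - c w\<close> vanishes at the witness
      \<open>x0\<close>.\<close>
    define c where "c = (r \<bullet> x0) / (w \<bullet> x0)"
    define r' where "r' = r - c \<cdot>\<^sub>v w"
    have r': "r' \<in> carrier_vec n" using w Cons.prems(2) by (simp add: r'_def)
    have "r' \<bullet> x = 0" if x: "x \<in> carrier_vec n" and ker: "\<forall>u \<in> set ws. u \<bullet> x = 0" for x
    proof -
      \<comment> \<open>Shifting \<open>x\<close> by \<open>d\<close> times \<open>x0\<close> stays
        in the kernel of \<open>ws\<close> and also kills \<open>w\<close>, so the hypothesis on
        \<open>r\<close> becomes applicable.\<close>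
      define d where "d = (w \<bullet> x) / (w \<bullet> x0)"
      have ux: "u \<bullet> (x - d \<cdot>\<^sub>v x0) = u \<bullet> x - d * (u \<bullet> x0)" if "u \<in> carrier_vec n" for u
        using that x x0(1) by (simp add: scalar_prod_minus_distrib)
      have "\<forall>u \<in> set (w # ws). u \<bullet> (x - d \<cdot>\<^sub>v x0) = 0"
        using ux ws w ker x0(2) wx0 by (auto simp: d_def subset_iff)
      then have "r \<bullet> (x - d \<cdot>\<^sub>v x0) = 0"
        using Cons.prems(3) x x0(1) by simp
      then have "r \<bullet> x = d * (r \<bullet> x0)" using ux[OF Cons.prems(2)] by simp
      moreover have "r' \<bullet> x = r \<bullet> x - c * (w \<bullet> x)"
        using w x Cons.prems(2) by (simp add: r'_def minus_scalar_prod_distrib)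
      ultimately show ?thesis by (simp add: c_def d_def)
    qed
    from Cons.IH[OF ws r' this] have "r' \<in> span (set (w # ws))" using mono by blast
    moreover have "c \<cdot>\<^sub>v w \<in> span (set (w # ws))"
      using in_own_span[OF Cons.prems(1)] by (intro smult_in_span Cons.prems(1)) auto
    ultimately have "r' + c \<cdot>\<^sub>v w \<in> span (set (w # ws))"
      using span_add1[OF Cons.prems(1)] by simp
    moreover have "r' + c \<cdot>\<^sub>v w = r"
      using w Cons.prems(2) by (intro eq_vecI) (auto simp: r'_def)
    ultimately show ?thesis by simp
  qed
qed

text \<open>A row space is the image of the transpose; the coefficient vectors \<open>u\<close> and
  \<open>v\<close> later serve as the weights of a linear decoder.\<close>

lemma row_space_sumE:
  assumes "r \<in> subspace_sum (row_space A) (row_space B)"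
    and "A \<in> carrier_mat k n" and "B \<in> carrier_mat l n"
  obtains u v where "u \<in> carrier_vec k" "v \<in> carrier_vec l" "r = A\<^sup>T *\<^sub>v u + B\<^sup>T *\<^sub>v v"
  using assms by (auto simp: submodule_sum_def row_space_eq)

text \<open>The common kernel of \<open>A\<close> and \<open>B\<close> consists of the vectors
  orthogonal to all rows of both, and the span of the joined row lists is the sum of the two row
  spaces.\<close>

lemma vanishing_on_kernels_in_row_space_sum:
  assumes A: "A \<in> carrier_mat k n" and B: "B \<in> carrier_mat l n" and r: "r \<in> carrier_vec n"
    and "\<And>x. x \<in> carrier_vec n \<Longrightarrow> A *\<^sub>v x = 0\<^sub>v k \<Longrightarrow> B *\<^sub>v x = 0\<^sub>v l \<Longrightarrow> r \<bullet> x = 0"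
  shows "r \<in> subspace_sum (row_space A) (row_space B)"
proof -
  have rows: "set (rows A) \<subseteq> carrier_vec n" "set (rows B) \<subseteq> carrier_vec n"
    using A B rows_carrier by blast+
  have kernel: "M *\<^sub>v x = 0\<^sub>v j"
    if "M \<in> carrier_mat j n" "\<forall>w \<in> set (rows M). w \<bullet> x = 0" for M j x
    using that by (intro eq_vecI) (auto simp: rows_def)
  have "r \<in> span (set (rows A @ rows B))"
    using rows r A B assms(4)
    by (intro vanishing_on_common_kernel_in_span) (auto simp: kernel)
  then show ?thesis
    using span_union_is_sum[OF rows] by (simp add: row_space_def)
qed

end

theorem mainTheorem1:
  fixes I :: "'a::{field, finite} iccsi"
    and VS L :: "'a mat" and V :: "nat \<Rightarrow> 'a mat" and N :: nat
  assumes "iccsi_instance I"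
    and "generator_matrices I VS V"
    and "0 < N"
    and "L \<in> carrier_mat N (sender_dim I)"
  shows "(\<exists>E. linear_index_code I VS V N E \<and> represents I VS N L E) \<longleftrightarrow>
    (\<forall>i < num_users I. row (request I) i \<in>
       subspace_plus (num_blocks I) (row_span (num_blocks I) (L * VS)) (user_space I i))"
proof -
  define t n where "t = data_width I" and "n = num_blocks I"
  define A where "A = L * VS"
  interpret vec_space "TYPE('a)" n .
  have t: "0 < t"
    using assms(1) by (simp add: iccsi_instance_def t_def)
  have A: "A \<in> carrier_mat N n"
    using assms(2,4) by (auto simp: A_def generator_matrices_def n_def)
  have V: "V i \<in> carrier_mat (user_dim I i) n" "row_space (V i) = user_space I i"
    and R: "row (request I) i \<in> carrier_vec n" if "i < num_users I" for i
    using assms(1,2) that by (auto simp: generator_matrices_def iccsi_instance_def n_def)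
  show ?thesis
    unfolding n_def[symmetric] A_def[symmetric]
  proof (intro iffI allI impI)
    fix i
    assume "\<exists>E. linear_index_code I VS V N E \<and> represents I VS N L E" and i: "i < num_users I"
    then obtain E D where E: "\<And>X. X \<in> carrier_mat n t \<Longrightarrow> E X = A * X"
      and D: "\<And>X. X \<in> carrier_mat n t \<Longrightarrow> D (E X, V i * X) = X\<^sup>T *\<^sub>v row (request I) i"
      unfolding linear_index_code_def index_code_def represents_def A_def n_def t_def by metis
    have "row (request I) i \<in> subspace_sum (row_space A) (row_space (V i))"
    proof (rule vanishing_on_kernels_in_row_space_sum[OF A V(1)[OF i] R[OF i]])
      fix x :: "'a vec"
      assume x: "x \<in> carrier_vec n" and ker: "A *\<^sub>v x = 0\<^sub>v N" "V i *\<^sub>v x = 0\<^sub>v (user_dim I i)"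
      \<comment> \<open>Since \<open>0 < t\<close>, the list has exactly \<open>t\<close> columns
        and there is room for \<open>x\<close>.\<close>
      define X where "X = mat_of_cols n (x # replicate (t - 1) (0\<^sub>v n))"
      have X: "X \<in> carrier_mat n t" and colX: "\<And>j. j < t \<Longrightarrow> col X j = (if j = 0 then x else 0\<^sub>v n)"
        using t x by (auto simp: X_def nth_Cons')
      \<comment> \<open>Used for both \<open>A\<close> and \<open>V i\<close>: the codeword and the
        side information agree for \<open>X\<close> and for the zero matrix, so \<open>D\<close>
        receives the same input twice.\<close>
      have zero: "M * X = M * 0\<^sub>m n t" if "M \<in> carrier_mat k n" "M *\<^sub>v x = 0\<^sub>v k" for M k
      proof (rule mat_col_eqI)
        fix j assume "j < dim_col (M * 0\<^sub>m n t)"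
        then have j: "j < t" by simp
        have "col (M * X) j = M *\<^sub>v col X j" "col (M * 0\<^sub>m n t) j = M *\<^sub>v col (0\<^sub>m n t) j"
          using that(1) X j by (auto intro!: col_mult2)
        then show "col (M * X) j = col (M * 0\<^sub>m n t) j"
          using that j colX by auto
      qed (use that X in auto)
      have "X\<^sup>T *\<^sub>v row (request I) i = (0\<^sub>m n t)\<^sup>T *\<^sub>v row (request I) i"
        using D[OF X] D[of "0\<^sub>m n t"] E[OF X] E[of "0\<^sub>m n t"] zero[OF A ker(1)] zero[OF V(1)[OF i] ker(2)]
        by simp
      \<comment> \<open>Entry 0 pairs the request with column 0 of the data matrix, which is
        \<open>x\<close> on the left and zero on the right.\<close>
      then have "(X\<^sup>T *\<^sub>v row (request I) i) $ 0 = ((0\<^sub>m n t)\<^sup>T *\<^sub>v row (request I) i) $ 0"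
        by simp
      then have "x \<bullet> row (request I) i = 0"
        using X R[OF i] t colX[OF t] by simp
      then show "row (request I) i \<bullet> x = 0"
        using comm_scalar_prod[OF x R[OF i]] by simp
    qed
    then show "row (request I) i \<in> subspace_sum (row_space A) (user_space I i)"
      by (simp add: V(2)[OF i])
  next
    assume sum: "\<forall>i < num_users I. row (request I) i \<in> subspace_sum (row_space A) (user_space I i)"
    define E where "E X = A * X" for X
    have rep: "represents I VS N L E"
      using assms(4) by (simp add: represents_def E_def A_def)
    have "\<exists>D \<in> carrier_mat N t \<times> carrier_mat (user_dim I i) t \<rightarrow> carrier_vec t.
        \<forall>X \<in> carrier_mat n t. D (E X, V i * X) = X\<^sup>T *\<^sub>v row (request I) i"
      if i: "i < num_users I" for i
    proof -
      from sum i obtain u v where u: "u \<in> carrier_vec N" and v: "v \<in> carrier_vec (user_dim I i)"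
        and Ri: "row (request I) i = A\<^sup>T *\<^sub>v u + (V i)\<^sup>T *\<^sub>v v"
        using row_space_sumE[OF _ A V(1)[OF i]] V(2)[OF i] by metis
      \<comment> \<open>The weights \<open>u\<close> and \<open>v\<close> depend only on the user,
        not on the data, so this is one decoder for all \<open>X\<close>.\<close>
      define D where "D = (\<lambda>(Y, Z). Y\<^sup>T *\<^sub>v u + Z\<^sup>T *\<^sub>v v)"
      have "D (E X, V i * X) = X\<^sup>T *\<^sub>v row (request I) i" if X: "X \<in> carrier_mat n t" for X
      proof -
        \<comment> \<open>Pulling \<open>X\<^sup>T\<close> to the front of both contributions lets
          their sum be read as \<open>X\<^sup>T\<close> applied to the request.\<close>
        have "(A * X)\<^sup>T *\<^sub>v u = X\<^sup>T *\<^sub>v (A\<^sup>T *\<^sub>v u)"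
          using A X u by (simp add: transpose_mult[OF A X] assoc_mult_mat_vec[of _ t n _ N])
        moreover have "(V i * X)\<^sup>T *\<^sub>v v = X\<^sup>T *\<^sub>v ((V i)\<^sup>T *\<^sub>v v)"
          using V(1)[OF i] X v
          by (simp add: transpose_mult[OF V(1)[OF i] X] assoc_mult_mat_vec[of _ t n _ "user_dim I i"])
        moreover have "X\<^sup>T *\<^sub>v (A\<^sup>T *\<^sub>v u + (V i)\<^sup>T *\<^sub>v v) = X\<^sup>T *\<^sub>v (A\<^sup>T *\<^sub>v u) + X\<^sup>T *\<^sub>v ((V i)\<^sup>T *\<^sub>v v)"
          using A V(1)[OF i] X u v by (intro mult_add_distrib_mat_vec[of _ t n]) auto
        ultimately show ?thesis by (simp add: D_def E_def Ri)
      qed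
      moreover have "D \<in> carrier_mat N t \<times> carrier_mat (user_dim I i) t \<rightarrow> carrier_vec t"
        using u v by (auto simp: D_def intro!: add_carrier_vec mult_mat_vec_carrier)
      ultimately show ?thesis by blast
    qed
    moreover have "E \<in> carrier_mat n t \<rightarrow> carrier_mat N t"
      using A by (auto simp: E_def)
    ultimately have "index_code I V N E"
      by (simp add: index_code_def n_def t_def)
    with rep show "\<exists>E. linear_index_code I VS V N E \<and> represents I VS N L E"
      unfolding linear_index_code_def by blast
  qed
qed

end
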